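(* Let $d\ge 1$ be an integer and let $\mathbf{x}^{(1)},\mathbf{x}^{(2)},\dots$ be the probability vectors (in $\mathbb{R}^d$, written as rows) of a time-dependent Markov chain with $d\times d$ doubly stochastic transition matrices $\mathfrak{D}_{12},\mathfrak{D}_{23},\dots$, i.e. $\mathbf{x}^{(1)}$ is a probability vector and $\mathbf{x}^{(s+1)}=\mathbf{x}^{(s)}\mathfrak{D}_{s,s+1}$ for all $s\ge 1$. Then, with the polytopes $\mathcal{A}[\mathbf{x}^{(s)}]$, $\Delta_0$, $\Delta_{d-1}$ and the entropy $E$ defined in the context: (1) for every $s\ge 1$, $$\Delta_0\subseteq \mathcal{A}[\mathbf{x}^{(s+1)}]\subseteq \mathcal{A}[\mathbf{x}^{(s)}]\subseteq \Delta_{d-1};$$ (2) for every $s\ge 1$, the minimum entropy of the probability vectors in $\mathcal{A}[\mathbf{x}^{(s)}]$ is $E(\mathbf{x}^{(s)})$, and this minimum entropy is non-decreasing in $s$: $E(\mathbf{x}^{(s)})\le E(\mathbf{x}^{(s+1)})\le\log d$.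
   Context: A probability vector is a row vector $\mathbf{x}=(x_0,\dots,x_{d-1})$ with $x_i\ge 0$ and $\sum_i x_i=1$. A $d\times d$ real matrix is doubly stochastic if its entries are non-negative and all its row sums and column sums equal $1$. The entropy of a probability vector is $E(\mathbf{x})=-\sum_a x_a\log x_a$ (with $0\log 0=0$). For a permutation $\pi$ of $\{0,\dots,d-1\}$, the permutation matrix $M_\pi$ has entries $M_\pi(a,b)=\delta(\pi(a),b)$ (Kronecker delta), and for a probability vector $\mathbf{x}$ one sets $\mathbf{x}_\pi=\mathbf{x}M_\pi=(x_{\pi^{-1}(0)},\dots,x_{\pi^{-1}(d-1)})$. A probability vector $\mathbf{x}$ is represented by its first $d-1$ components, $\widehat{\mathbf{x}}=(x_0,\dots,x_{d-2})$ (the last component is determined by the others). The convex polytope associated with $\mathbf{x}$ is $$\mathcal{A}[\mathbf{x}]=\Big\{\sum_{\pi}\lambda(\pi)\,\widehat{\mathbf{x}}_\pi \;:\; \lambda(\pi)\ge 0,\ \sum_\pi\lambda(\pi)=1\Big\},$$ the sums running over all $d!$ permutations $\pi$. A probability vector $\mathbf{y}$ is said to be in $\mathcal{A}[\mathbf{x}]$ if $\widehat{\mathbf{y}}\in\mathcal{A}[\mathbf{x}]$, and its entropy is $E(\mathbf{y})$, computed with all $d$ components. $\Delta_{d-1}=\{(t_0,\dots,t_{d-2}) : t_i\ge 0,\ \sum_{i=0}^{d-2}t_i\le 1\}$ is the simplex of all $\widehat{\mathbf{x}}$ with $\mathbf{x}$ a probability vector, and $\Delta_0=\{(\tfrac1d,\dots,\tfrac1d)\}$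 is the single point $\widehat{\mathbf{u}}$ representing the uniform vector $\mathbf{u}=(\tfrac1d,\dots,\tfrac1d)$. *)

theory Defs
  imports Complex_Main "HOL-Combinatorics.Permutations" "Jordan_Normal_Form.Matrix"
begin

definition prob_vec :: "nat \<Rightarrow> real vec \<Rightarrow> bool" where
  "prob_vec d x \<longleftrightarrow> x \<in> carrier_vec d \<and> (\<forall>i<d. 0 \<le> x $ i) \<and> (\<Sum>i<d. x $ i) = 1"

definition doubly_stochastic :: "nat \<Rightarrow> real mat \<Rightarrow> bool" where
  "doubly_stochastic d A \<longleftrightarrow> A \<in> carrier_mat d d \<and>
     (\<forall>a<d. \<forall>b<d. 0 \<le> A $$ (a, b)) \<and>
     (\<forall>a<d. (\<Sum>b<d. A $$ (a, b)) = 1) \<and>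
     (\<forall>b<d. (\<Sum>a<d. A $$ (a, b)) = 1)"

(* Row vector times matrix; the matrix library has only matrix times column vector. *)
definition vec_mult_mat :: "real vec \<Rightarrow> real mat \<Rightarrow> real vec" (infixl \<open>\<^sub>v*\<close> 70) where
  "x \<^sub>v* A = vec (dim_col A) (\<lambda>b. x \<bullet> col A b)"

(* Natural logarithm; the convention 0 log 0 = 0 holds automatically. *)
definition entropy :: "real vec \<Rightarrow> real" where
  "entropy x = - (\<Sum>a<dim_vec x. x $ a * ln (x $ a))"

definition perm_mat :: "nat \<Rightarrow> (nat \<Rightarrow> nat) \<Rightarrow> real mat" where
  "perm_mat d \<pi> = mat d d (\<lambda>(a, b). if \<pi> a = b then 1 else 0)"

definition perm_vec :: "real vec \<Rightarrow> (nat \<Rightarrow> nat) \<Rightarrow> real vec" where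
  "perm_vec x \<pi> = x \<^sub>v* perm_mat (dim_vec x) \<pi>"

definition hat :: "real vec \<Rightarrow> real vec" where
  "hat x = vec_first x (dim_vec x - 1)"

definition perms :: "nat \<Rightarrow> (nat \<Rightarrow> nat) set" where
  "perms d = {\<pi>. \<pi> permutes {..<d}}"

definition perm_polytope :: "real vec \<Rightarrow> real vec set" where
  "perm_polytope x =
     {finsum_vec TYPE(real) (dim_vec x - 1) (\<lambda>\<pi>. c \<pi> \<cdot>\<^sub>v hat (perm_vec x \<pi>)) (perms (dim_vec x)) | c.
        (\<forall>\<pi>\<in>perms (dim_vec x). 0 \<le> c \<pi>) \<and> (\<Sum>\<pi>\<in>perms (dim_vec x). c \<pi>) = 1}"

definition prob_vecs_in_polytope :: "real vec \<Rightarrow> real vec set" where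
  "prob_vecs_in_polytope x = {y. prob_vec (dim_vec x) y \<and> hat y \<in> perm_polytope x}"

(* The simplex Delta_k in k coordinates; it is used with k = d - 1. *)
definition std_simplex :: "nat \<Rightarrow> real vec set" where
  "std_simplex k = {t \<in> carrier_vec k. (\<forall>i<k. 0 \<le> t $ i) \<and> (\<Sum>i<k. t $ i) \<le> 1}"

(* Not std_simplex 0: this is the point of R^(d-1) representing the uniform vector of length d. *)
definition uniform_point :: "nat \<Rightarrow> real vec set" where
  "uniform_point d = {vec (d - 1) (\<lambda>_. 1 / real d)}"

definition is_minimum :: "real set \<Rightarrow> real \<Rightarrow> bool" where
  "is_minimum S m \<longleftrightarrow> m \<in> S \<and> (\<forall>e\<in>S. m \<le> e)"

end

(* The polytope of x consists of the truncations of the vectors majorized by x, and everything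
   follows from this. One step y = x D of the chain is majorized by x because t \<mapsto> max 0 (t - c) is
   convex, and majorization is transitive. Conversely, a vector y majorized by x is reached from x
   by T-transforms: match the largest entry of y by pinching together the two entries of x that
   enclose it most tightly, then delete it. T-transforms preserve the convex hull of the
   permutations of x. The entropy bound is Jensen's inequality for t ln t on that hull. *)

theory Submission
  imports Defs
begin

section \<open>Majorization of functions on an index set\<close>

(* Testing against the functions max 0 (u - t) characterizes majorization without sorting. *)

definition majorized_on :: "'a set \<Rightarrow> ('a \<Rightarrow> real) \<Rightarrow> ('a \<Rightarrow> real) \<Rightarrow> bool" where
  "majorized_on I y x \<longleftrightarrow> sum y I = sum x I \<and>
     (\<forall>t. (\<Sum>i\<in>I. max 0 (y i - t)) \<le> (\<Sum>i\<in>I. max 0 (x i - t)))"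

text \<open>Mixing \<open>x\<close> with a transposed copy, rather than updating two entries, makes
  it easy to see that hulls of permutations are preserved; \<open>t = 1\<close> is a plain
  swap.\<close>

definition T_transform :: "'a set \<Rightarrow> ('a \<Rightarrow> real) \<Rightarrow> ('a \<Rightarrow> real) \<Rightarrow> bool" where
  "T_transform I x y \<longleftrightarrow> (\<exists>i\<in>I. \<exists>j\<in>I. \<exists>t. 0 \<le> t \<and> t \<le> 1 \<and>
     y = (\<lambda>k. (1 - t) * x k + t * x (transpose i j k)))"

lemma majorized_on_refl: "majorized_on I x x"
  by (simp add: majorized_on_def)

lemma majorized_on_trans:
  "majorized_on I z y \<Longrightarrow> majorized_on I y x \<Longrightarrow> majorized_on I z x"
  by (simp add: majorized_on_def) (blast intro: order_trans)

lemma majorized_on_permute: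
  assumes "\<pi> permutes I"
  shows "majorized_on I y (x \<circ> \<pi>) \<longleftrightarrow> majorized_on I y x"
proof -
  have "(\<Sum>i\<in>I. f (x (\<pi> i))) = (\<Sum>i\<in>I. f (x i))" for f :: "real \<Rightarrow> real"
    using sum.permute[OF assms, of "\<lambda>i. f (x i)"] by (simp add: o_def)
  from this[of "\<lambda>u. u"] this[of "\<lambda>u. max 0 (u - t)" for t] show ?thesis
    by (simp add: majorized_on_def)
qed

text \<open>A common entry contributes the same term to both sides of every comparison, so it
  cancels.\<close>

lemma majorized_on_remove:
  assumes "finite I" "p \<in> I" "x p = y p" "majorized_on I y x"
  shows "majorized_on (I - {p}) y x"
  using assms unfolding majorized_on_def
  by (simp add: sum.remove[OF assms(1,2)])

section \<open>From majorization to T-transforms\<close>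

lemma T_transform_mono: "T_transform I x y \<Longrightarrow> I \<subseteq> J \<Longrightarrow> T_transform J x y"
  unfolding T_transform_def by blast

lemma T_transform_swap: "i \<in> I \<Longrightarrow> j \<in> I \<Longrightarrow> T_transform I x (x \<circ> transpose i j)"
  unfolding T_transform_def by (rule bexI[of _ i], rule bexI[of _ j], rule exI[of _ 1]) auto

lemma T_transform_pinch:
  assumes "p \<in> I" "b \<in> I" "x b < u" "u < x p"
  shows "T_transform I x (x(p := u, b := x p + x b - u))"
proof -
  \<comment> \<open>\<open>t\<close> solves \<open>(1 - t) * x p + t * x b = u\<close>; the entry at
    \<open>b\<close> follows because the sum is preserved.\<close>
  define t where "t = (x p - u) / (x p - x b)"
  have t: "t * (x p - x b) = x p - u" "0 \<le> t" "t \<le> 1"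
    using assms by (auto simp: t_def field_simps)
  have "x(p := u, b := x p + x b - u) = (\<lambda>k. (1 - t) * x k + t * x (transpose p b k))"
    using t(1) assms by (auto simp: fun_eq_iff transpose_def algebra_simps)
  then show ?thesis
    unfolding T_transform_def using assms t by blast
qed

text \<open>The entries \<open>x p\<close> and \<open>x b\<close> become \<open>y p\<close> and the
  remainder \<open>x p + x b - y p\<close>, after which the matched index \<open>p\<close> is
  dropped. Only thresholds between \<open>x b\<close> and \<open>y p\<close> are delicate; there
  \<open>gap\<close> makes the contribution of the other entries affine in the threshold.\<close>

lemma majorized_on_pinch:
  fixes x y :: "'a \<Rightarrow> real"
  assumes fin: "finite I" and p: "p \<in> I" and b: "b \<in> I"
    and maj: "majorized_on I y x"
    and ymax: "\<And>i. i \<in> I \<Longrightarrow> y i \<le> y p"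
    and lt: "x b < y p" "y p < x p"
    and gap: "\<And>i. i \<in> I \<Longrightarrow> x i \<le> x b \<or> x p \<le> x i"
  shows "majorized_on (I - {p}) y (x(p := y p, b := x p + x b - y p))"
    (is "majorized_on _ y ?z")
proof -
  define J where "J = I - {p} - {b}"
  have finJ: "finite J" using fin by (simp add: J_def)
  have bp: "b \<noteq> p" using lt by auto
  have b': "b \<in> I - {p}" "finite (I - {p})" using b bp fin by auto
  have splitx: "(\<Sum>i\<in>I. f (x i)) = f (x p) + (f (x b) + (\<Sum>i\<in>J. f (x i)))" for f :: "real \<Rightarrow> real"
    by (simp add: sum.remove[OF fin p] sum.remove[OF b'(2,1)] J_def)
  have splitz: "(\<Sum>i\<in>I - {p}. f (?z i)) = f (x p + x b - y p) + (\<Sum>i\<in>J. f (x i))"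
    for f :: "real \<Rightarrow> real"
    by (simp add: sum.remove[OF b'(2,1)] J_def)
  have splity: "(\<Sum>i\<in>I. f (y i)) = f (y p) + (\<Sum>i\<in>I - {p}. f (y i))" for f :: "real \<Rightarrow> real"
    by (simp add: sum.remove[OF fin p])
  have le: "max 0 (y p - t) + (\<Sum>i\<in>I - {p}. max 0 (y i - t))
      \<le> max 0 (x p - t) + (max 0 (x b - t) + (\<Sum>i\<in>J. max 0 (x i - t)))" for t
    using maj[unfolded majorized_on_def, THEN conjunct2, rule_format, of t]
    unfolding splitx[of "\<lambda>u. max 0 (u - t)"] splity[of "\<lambda>u. max 0 (u - t)"] .
  have "sum y (I - {p}) = sum ?z (I - {p})"
    using maj splitx[of "\<lambda>u. u"] splity[of "\<lambda>u. u"] splitz[of "\<lambda>u. u"]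
    by (simp add: majorized_on_def)
  moreover have "(\<Sum>i\<in>I - {p}. max 0 (y i - t)) \<le> (\<Sum>i\<in>I - {p}. max 0 (?z i - t))" for t
  proof -
    define c where "c = x p + x b - y p"
    have "(\<Sum>i\<in>I - {p}. max 0 (y i - t)) \<le> max 0 (c - t) + (\<Sum>i\<in>J. max 0 (x i - t))"
    proof -
      have nn: "0 \<le> (\<Sum>i\<in>J. max 0 (x i - t))" by (simp add: sum_nonneg)
      \<comment> \<open>From \<open>y p\<close> upward the left side vanishes, as \<open>y p\<close>
        is the largest entry. Up to \<open>x b\<close> all entries of the old and new pair are at
        least \<open>t\<close>, so subtracting \<open>y p - t\<close> from \<open>le\<close> gives
        the claim.\<close>
      consider "y p \<le> t" | "t \<le> x b" | "x b < t" "t < y p" by linarith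
      then show ?thesis
      proof cases
        case 1
        then have "(\<Sum>i\<in>I - {p}. max 0 (y i - t)) = 0"
          using ymax by (intro sum.neutral) force
        then show ?thesis using nn by simp
      next
        case 2
        then show ?thesis using le[of t] lt unfolding c_def by linarith
      next
        case 3
        define K where "K = {i\<in>J. x p \<le> x i}"
        define M where "M = {i\<in>I - {p}. t < y i}"
        have K: "K \<subseteq> J" "finite K" using finJ by (auto simp: K_def)
        have M: "M \<subseteq> I - {p}" "finite M" using fin by (auto simp: M_def)
        \<comment> \<open>By \<open>gap\<close> no entry indexed by \<open>J\<close> lies strictly
          between \<open>x b\<close> and \<open>x p\<close>, so all these thresholds
          \<open>s\<close> select the same set \<open>K\<close>.\<close>
        have J_sum: "(\<Sum>i\<in>J. max 0 (x i - s)) = (\<Sum>i\<in>K. x i - s)" if "x b \<le> s" "s < x p" for s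
        proof -
          have "(\<Sum>i\<in>J. max 0 (x i - s)) = (\<Sum>i\<in>K. max 0 (x i - s))"
            using that gap finJ by (intro sum.mono_neutral_right) (force simp: K_def J_def)+
          also have "\<dots> = (\<Sum>i\<in>K. x i - s)"
            using that by (intro sum.cong) (auto simp: K_def)
          finally show ?thesis .
        qed
        have J_t: "(\<Sum>i\<in>J. max 0 (x i - t)) = (\<Sum>i\<in>K. x i - t)"
          using 3 lt by (intro J_sum) auto
        have "(\<Sum>i\<in>J. max 0 (x i - x b)) = (\<Sum>i\<in>K. x i - x b)"
          using lt by (intro J_sum) auto
        also have "\<dots> = (\<Sum>i\<in>K. x i - t) + card K * (t - x b)"
          by (simp add: sum_subtractf algebra_simps)
        finally have J_b: "(\<Sum>i\<in>J. max 0 (x i - x b)) = (\<Sum>i\<in>K. x i - t) + card K * (t - x b)" .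
        have M_t: "(\<Sum>i\<in>I - {p}. max 0 (y i - t)) = (\<Sum>i\<in>M. y i - t)"
        proof -
          have "(\<Sum>i\<in>I - {p}. max 0 (y i - t)) = (\<Sum>i\<in>M. max 0 (y i - t))"
            using fin by (intro sum.mono_neutral_right) (auto simp: M_def)
          also have "\<dots> = (\<Sum>i\<in>M. y i - t)"
            by (intro sum.cong) (auto simp: M_def)
          finally show ?thesis .
        qed
        \<comment> \<open>With few summands on the left, compare termwise with \<open>K\<close>, since \<open>y i \<le> y p \<le> x p\<close>.
          With many, lower the threshold from \<open>t\<close> to \<open>x b\<close>: the left side then grows at least
          as fast as the right side, and at \<open>x b\<close> the majorization hypothesis applies.\<close>
        show ?thesis
        proof (cases "card M \<le> card K")
          case True
          have "(\<Sum>i\<in>M. y i - t) \<le> card M * (y p - t)"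
            using ymax M by (intro sum_bounded_above) auto
          also have "\<dots> \<le> card K * (x p - t)"
            using True 3 lt by (intro mult_mono) auto
          also have "\<dots> \<le> (\<Sum>i\<in>K. x i - t)"
            by (intro sum_bounded_below) (auto simp: K_def)
          finally show ?thesis using M_t J_t by simp
        next
          case False
          have "(\<Sum>i\<in>M. y i - t) + card M * (t - x b) = (\<Sum>i\<in>M. y i - x b)"
            by (simp add: sum_subtractf algebra_simps)
          also have "\<dots> \<le> (\<Sum>i\<in>M. max 0 (y i - x b))"
            by (intro sum_mono) simp
          also have "\<dots> \<le> (\<Sum>i\<in>I - {p}. max 0 (y i - x b))"
            using M fin by (intro sum_mono2) auto
          also have "\<dots> \<le> x p - y p + (\<Sum>i\<in>K. x i - t) + card K * (t - x b)"
            using le[of "x b"] J_b lt by simp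
          finally have *: "(\<Sum>i\<in>M. y i - t) + card M * (t - x b)
              \<le> x p - y p + (\<Sum>i\<in>K. x i - t) + card K * (t - x b)" .
          \<comment> \<open>Here \<open>card M\<close> is at least \<open>card K + 1\<close>; the
            extra copy of \<open>t - x b\<close> turns \<open>x p - y p\<close> into
            \<open>c - t\<close>.\<close>
          have "(real (card K) + 1) * (t - x b) \<le> card M * (t - x b)"
            using False 3 by (intro mult_right_mono) auto
          then have "real (card K) * (t - x b) + (t - x b) \<le> card M * (t - x b)"
            by (simp add: distrib_right)
          then have "(\<Sum>i\<in>M. y i - t) \<le> c - t + (\<Sum>i\<in>K. x i - t)"
            using * unfolding c_def by linarith
          then show ?thesis using M_t J_t by simp
        qed
      qed
    qed
    then show ?thesis using splitz[of "\<lambda>u. max 0 (u - t)"] by (simp add: c_def)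
  qed
  ultimately show ?thesis unfolding majorized_on_def by blast
qed

text \<open>A swap suffices if \<open>x\<close> already takes the value \<open>y p\<close>.
  Otherwise the nearest entries above and below it exist, and being nearest they satisfy the
  hypothesis \<open>gap\<close> of the pinching lemma.\<close>

lemma majorized_on_match_max:
  fixes x y :: "'a \<Rightarrow> real"
  assumes fin: "finite I" and p: "p \<in> I"
    and maj: "majorized_on I y x"
    and ymax: "\<And>i. i \<in> I \<Longrightarrow> y i \<le> y p"
  obtains z where "(T_transform I)\<^sup>*\<^sup>* x z" "z p = y p" "majorized_on (I - {p}) y z"
    "\<And>i. i \<notin> I \<Longrightarrow> z i = x i"
proof (cases "\<exists>a\<in>I. x a = y p")
  case True
  then obtain a where a: "a \<in> I" "x a = y p" by blast
  have perm: "transpose a p permutes I" using a p by (simp add: permutes_swap_id)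
  let ?z = "x \<circ> transpose a p"
  have "T_transform I x ?z" using a p by (intro T_transform_swap)
  moreover have "majorized_on (I - {p}) y ?z"
    using fin p a maj majorized_on_permute[OF perm] by (intro majorized_on_remove) auto
  ultimately show ?thesis
    using a permutes_not_in[OF perm] by (intro that[of ?z]) auto
next
  case False
  define A where "A = {a\<in>I. y p < x a}"
  define B where "B = {a\<in>I. x a < y p}"
  have AB: "finite A" "finite B" using fin by (auto simp: A_def B_def)
  have A_or_B: "i \<in> A \<or> i \<in> B" if "i \<in> I" for i
    using False that by (force simp: A_def B_def)
  \<comment> \<open>Otherwise the maximum \<open>m\<close> of \<open>x\<close> is below
    \<open>y p\<close>, and the test at threshold \<open>m\<close> is positive for \<open>y\<close>
    but zero for \<open>x\<close>.\<close>
  have "A \<noteq> {}"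
  proof
    assume "A = {}"
    then have less: "x i < y p" if "i \<in> I" for i using A_or_B[OF that] by (simp add: B_def)
    define m where "m = Max (x ` I)"
    have m: "x i \<le> m" if "i \<in> I" for i using fin that by (simp add: m_def)
    have "m \<in> x ` I" unfolding m_def using fin p by (intro Max_in) auto
    then have "m < y p" using less by auto
    then have "0 < max 0 (y p - m)" by simp
    also have "\<dots> \<le> (\<Sum>i\<in>I. max 0 (y i - m))"
      using fin p by (intro member_le_sum) auto
    also have "\<dots> \<le> (\<Sum>i\<in>I. max 0 (x i - m))" using maj by (simp add: majorized_on_def)
    also have "\<dots> = 0" using m by (intro sum.neutral) force
    finally show False by simp
  qed
  then obtain a where a: "a \<in> A" "\<And>i. i \<in> A \<Longrightarrow> x a \<le> x i"
    using AB(1) by (metis arg_min_if_finite(1) arg_min_least)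
  \<comment> \<open>Otherwise \<open>x\<close> exceeds \<open>y p\<close>, hence \<open>y\<close>,
    at every index, against the equality of sums.\<close>
  have "B \<noteq> {}"
  proof
    assume "B = {}"
    then have "y i < x i" if "i \<in> I" for i
      using A_or_B[OF that] ymax[OF that] by (simp add: A_def)
    then have "sum y I < sum x I" using fin p by (intro sum_strict_mono) auto
    then show False using maj by (simp add: majorized_on_def)
  qed
  then have "Max (x ` B) \<in> x ` B" using AB by simp
  then obtain b where b: "b \<in> B" "x b = Max (x ` B)" by auto
  then have bmax: "x i \<le> x b" if "i \<in> B" for i using that AB by simp
  have ab: "a \<in> I" "b \<in> I" "x b < y p" "y p < x a" "a \<noteq> b"
    using a b by (auto simp: A_def B_def)
  have perm: "transpose a p permutes I" using ab p by (simp add: permutes_swap_id)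
  \<comment> \<open>The swap brings the upper entry to position \<open>p\<close>; \<open>b'\<close>
    tracks the lower one, which may itself have been at \<open>p\<close>.\<close>
  define w where "w = x \<circ> transpose a p"
  define b' where "b' = transpose a p b"
  have w: "w p = x a" "w b' = x b" by (simp_all add: w_def b'_def)
  have b'I: "b' \<in> I" using permutes_in_image[OF perm] ab by (simp add: b'_def)
  have gap: "w i \<le> w b' \<or> w p \<le> w i" if "i \<in> I" for i
  proof -
    have "transpose a p i \<in> A \<or> transpose a p i \<in> B"
      using permutes_in_image[OF perm] that by (intro A_or_B) simp
    then show ?thesis using a(2) bmax w by (auto simp: w_def)
  qed
  let ?z = "w(p := y p, b' := w p + w b' - y p)"
  have bp: "b' \<noteq> p" using w ab by auto
  have "majorized_on I y w" using maj majorized_on_permute[OF perm] by (simp add: w_def)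
  then have "majorized_on (I - {p}) y ?z"
    using fin p b'I ymax ab w gap by (intro majorized_on_pinch) auto
  moreover have "T_transform I x w" unfolding w_def using ab p by (intro T_transform_swap)
  moreover have "T_transform I w ?z" using p b'I ab w by (intro T_transform_pinch) auto
  ultimately show ?thesis
    using bp permutes_not_in[OF perm] p b'I
    by (intro that[of ?z]) (auto simp: w_def intro: rtranclp.rtrancl_into_rtrancl)
qed

text \<open>Each round freezes the matched index \<open>p\<close>, and later transforms act only
  inside \<open>I - {p}\<close>. Agreement off \<open>I\<close> is assumed because T-transforms on
  \<open>I\<close> never change those values.\<close>

lemma majorized_on_imp_T_transforms:
  assumes "finite I" "majorized_on I y x" "\<And>i. i \<notin> I \<Longrightarrow> y i = x i"
  shows "(T_transform I)\<^sup>*\<^sup>* x y"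
  using assms
proof (induction "card I" arbitrary: I x)
  case 0
  then have "y = x" by auto
  then show ?case by simp
next
  case (Suc n)
  then have "Max (y ` I) \<in> y ` I" by (metis Max_in card.empty empty_is_image finite_imageI nat.distinct(1))
  then obtain p where p: "p \<in> I" "y p = Max (y ` I)" by auto
  then have ymax: "y i \<le> y p" if "i \<in> I" for i using that Suc.prems by simp
  from majorized_on_match_max[OF Suc.prems(1) p(1) Suc.prems(2) ymax]
  obtain z where z: "(T_transform I)\<^sup>*\<^sup>* x z" "z p = y p" "majorized_on (I - {p}) y z"
    "\<And>i. i \<notin> I \<Longrightarrow> z i = x i" by blast
  have "(T_transform (I - {p}))\<^sup>*\<^sup>* z y"
    using Suc z p by (intro Suc.hyps(1)) auto
  then have "(T_transform I)\<^sup>*\<^sup>* z y"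
    by (rule rtranclp_mono[THEN predicate2D, rotated]) (auto intro: T_transform_mono)
  with z(1) show ?case by (rule rtranclp_trans)
qed

section \<open>The convex hull of the permutations of a vector\<close>

text \<open>Values of \<open>y\<close> off \<open>I\<close> are left free. Permutations act as
  \<open>x (\<pi> i)\<close>, so inverses appear only in the passage to permutation
  matrices.\<close>

definition in_perm_hull :: "'a set \<Rightarrow> ('a \<Rightarrow> real) \<Rightarrow> ('a \<Rightarrow> real) \<Rightarrow> bool" where
  "in_perm_hull I x y \<longleftrightarrow> (\<exists>c. (\<forall>\<pi>. \<pi> permutes I \<longrightarrow> 0 \<le> c \<pi>) \<and>
     (\<Sum>\<pi> | \<pi> permutes I. c \<pi>) = 1 \<and>
     (\<forall>i\<in>I. y i = (\<Sum>\<pi> | \<pi> permutes I. c \<pi> * x (\<pi> i))))"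

lemma in_perm_hull_refl:
  assumes "finite I" shows "in_perm_hull I x x"
proof -
  have "(\<Sum>\<pi> | \<pi> permutes I. if \<pi> = id then 1 else 0) = (1::real)"
    using assms by (subst sum.delta) (auto simp: finite_permutations permutes_id)
  moreover have "(\<Sum>\<pi> | \<pi> permutes I. (if \<pi> = id then 1 else 0) * x (\<pi> i)) = x i" for i
  proof -
    have "(\<Sum>\<pi> | \<pi> permutes I. (if \<pi> = id then 1 else 0) * x (\<pi> i))
       = (\<Sum>\<pi> | \<pi> permutes I. if \<pi> = id then x i else 0)"
      by (intro sum.cong) auto
    also have "\<dots> = x i"
      using assms by (subst sum.delta) (auto simp: finite_permutations permutes_id)
    finally show ?thesis .
  qed
  ultimately show ?thesis
    unfolding in_perm_hull_def by (intro exI[of _ "\<lambda>\<pi>. if \<pi> = id then 1 else 0"]) auto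
qed

text \<open>Transposing \<open>y\<close> composes each permutation on the right with the
  transposition, so the new weights mix \<open>c\<close> with a reindexed copy of itself.\<close>

lemma in_perm_hull_T_transform:
  assumes hull: "in_perm_hull I x y" and T: "T_transform I y z"
  shows "in_perm_hull I x z"
proof -
  let ?P = "{\<pi>. \<pi> permutes I}"
  from hull obtain c where c: "\<And>\<pi>. \<pi> permutes I \<Longrightarrow> 0 \<le> c \<pi>" "(\<Sum>\<pi>\<in>?P. c \<pi>) = 1"
    and y: "\<And>i. i \<in> I \<Longrightarrow> y i = (\<Sum>\<pi>\<in>?P. c \<pi> * x (\<pi> i))"
    unfolding in_perm_hull_def by blast
  from T obtain i j t where ij: "i \<in> I" "j \<in> I" and t: "0 \<le> t" "t \<le> 1"
    and z: "\<And>k. z k = (1 - t) * y k + t * y (transpose i j k)"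
    unfolding T_transform_def by blast
  let ?\<tau> = "transpose i j"
  have \<tau>: "?\<tau> permutes I" using ij by (simp add: permutes_swap_id)
  let ?c = "\<lambda>\<pi>. (1 - t) * c \<pi> + t * c (\<pi> \<circ> ?\<tau>)"
  have shift: "(\<Sum>\<pi>\<in>?P. f (\<pi> \<circ> ?\<tau>)) = (\<Sum>\<pi>\<in>?P. f \<pi>)" for f :: "_ \<Rightarrow> real"
    using sum_permutations_compose_right[OF \<tau>, of f] by simp
  have "(\<Sum>\<pi>\<in>?P. ?c \<pi>) = 1"
    using c(2) shift[of c] by (simp add: sum.distrib sum_distrib_left[symmetric])
  moreover have "0 \<le> ?c \<pi>" if "\<pi> permutes I" for \<pi>
    using c(1)[OF that] c(1)[OF permutes_compose[OF \<tau> that]] t by simp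
  moreover have "z k = (\<Sum>\<pi>\<in>?P. ?c \<pi> * x (\<pi> k))" if "k \<in> I" for k
  proof -
    have "y (?\<tau> k) = (\<Sum>\<pi>\<in>?P. c \<pi> * x (\<pi> (?\<tau> k)))"
      using that permutes_in_image[OF \<tau>] by (intro y) simp
    \<comment> \<open>Composing twice with the involution \<open>?\<tau>\<close> changes nothing but
      exposes a function of \<open>\<pi> \<circ> ?\<tau>\<close>, which \<open>shift\<close>
      reindexes.\<close>
    also have "\<dots> = (\<Sum>\<pi>\<in>?P. c (\<pi> \<circ> ?\<tau> \<circ> ?\<tau>) * x ((\<pi> \<circ> ?\<tau>) k))"
      by (simp add: o_assoc[symmetric])
    also have "\<dots> = (\<Sum>\<pi>\<in>?P. c (\<pi> \<circ> ?\<tau>) * x (\<pi> k))"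
      by (rule shift[of "\<lambda>\<pi>. c (\<pi> \<circ> ?\<tau>) * x (\<pi> k)"])
    finally have "z k = (1 - t) * (\<Sum>\<pi>\<in>?P. c \<pi> * x (\<pi> k)) +
        t * (\<Sum>\<pi>\<in>?P. c (\<pi> \<circ> ?\<tau>) * x (\<pi> k))"
      by (simp only: z y[OF that])
    then show ?thesis
      by (simp only: distrib_right sum.distrib mult.assoc sum_distrib_left)
  qed
  ultimately show ?thesis unfolding in_perm_hull_def by (intro exI[of _ ?c]) simp
qed

text \<open>The hard half of Rado's theorem: T-transforms lead from \<open>x\<close> to
  \<open>y\<close> without leaving the hull of \<open>x\<close>.\<close>

lemma majorized_on_imp_in_perm_hull:
  assumes "finite I" "majorized_on I y x"
  shows "in_perm_hull I x y"
proof -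
  \<comment> \<open>Off \<open>I\<close> the target of the T-transforms must agree with
    \<open>x\<close>; the hull condition ignores these values.\<close>
  let ?y = "\<lambda>i. if i \<in> I then y i else x i"
  have "majorized_on I ?y x"
    using assms by (simp add: majorized_on_def)
  then have "(T_transform I)\<^sup>*\<^sup>* x ?y"
    using assms by (intro majorized_on_imp_T_transforms) auto
  then have "in_perm_hull I x ?y"
    by (induction rule: rtranclp_induct)
      (auto intro: in_perm_hull_refl[OF assms(1)] in_perm_hull_T_transform)
  then show ?thesis unfolding in_perm_hull_def by simp
qed

section \<open>Jensen's inequality on the hull\<close>

text \<open>Jensen is applied at each index; after exchanging sums, every permuted sum equals the
  original one. \<open>jensen\<close> concerns only values taken by \<open>x\<close>, so
  \<open>f\<close> may be convex merely on the nonnegative reals.\<close>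

lemma in_perm_hull_sum_convex_le:
  fixes x y :: "'a \<Rightarrow> real"
  assumes hull: "in_perm_hull I x y"
    and jensen: "\<And>(c :: ('a \<Rightarrow> 'a) \<Rightarrow> real) v. (\<And>\<pi>. \<pi> permutes I \<Longrightarrow> 0 \<le> c \<pi>) \<Longrightarrow>
      (\<Sum>\<pi> | \<pi> permutes I. c \<pi>) = 1 \<Longrightarrow> (\<And>\<pi>. \<pi> permutes I \<Longrightarrow> v \<pi> \<in> x ` I) \<Longrightarrow>
      f (\<Sum>\<pi> | \<pi> permutes I. c \<pi> * v \<pi>) \<le> (\<Sum>\<pi> | \<pi> permutes I. c \<pi> * f (v \<pi>))"
  shows "(\<Sum>i\<in>I. f (y i)) \<le> (\<Sum>i\<in>I. f (x i) :: real)"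
proof -
  let ?P = "{\<pi>. \<pi> permutes I}"
  from hull obtain c where c: "\<And>\<pi>. \<pi> permutes I \<Longrightarrow> 0 \<le> c \<pi>" "(\<Sum>\<pi>\<in>?P. c \<pi>) = 1"
    and y: "\<And>i. i \<in> I \<Longrightarrow> y i = (\<Sum>\<pi>\<in>?P. c \<pi> * x (\<pi> i))"
    unfolding in_perm_hull_def by blast
  have "(\<Sum>i\<in>I. f (y i)) \<le> (\<Sum>i\<in>I. \<Sum>\<pi>\<in>?P. c \<pi> * f (x (\<pi> i)))"
  proof (intro sum_mono)
    fix i assume "i \<in> I"
    then show "f (y i) \<le> (\<Sum>\<pi>\<in>?P. c \<pi> * f (x (\<pi> i)))"
      unfolding y[OF \<open>i \<in> I\<close>] using c
      by (intro jensen) (auto simp: permutes_in_image)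
  qed
  also have "\<dots> = (\<Sum>\<pi>\<in>?P. c \<pi> * (\<Sum>i\<in>I. f (x (\<pi> i))))"
    by (subst sum.swap) (simp add: sum_distrib_left)
  also have "\<dots> = (\<Sum>\<pi>\<in>?P. c \<pi> * (\<Sum>i\<in>I. f (x i)))"
    using sum.permute[of _ I "\<lambda>i. f (x i)"]
    by (intro sum.cong) (auto simp: o_def)
  also have "\<dots> = (\<Sum>i\<in>I. f (x i))"
    using c(2) by (simp add: sum_distrib_right[symmetric])
  finally show ?thesis .
qed

text \<open>The weights are arbitrary because the lemma serves both for permutation weights and for
  the columns of a doubly stochastic matrix.\<close>

lemma pos_part_weighted_sum_le:
  fixes c v :: "'a \<Rightarrow> real"
  assumes "\<And>a. a \<in> A \<Longrightarrow> 0 \<le> c a" "sum c A = 1"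
  shows "max 0 ((\<Sum>a\<in>A. c a * v a) - t) \<le> (\<Sum>a\<in>A. c a * max 0 (v a - t))"
proof -
  have "(\<Sum>a\<in>A. c a * v a) - t = (\<Sum>a\<in>A. c a * (v a - t))"
    using assms by (simp add: right_diff_distrib sum_subtractf sum_distrib_right[symmetric])
  also have "\<dots> \<le> (\<Sum>a\<in>A. c a * max 0 (v a - t))"
    using assms by (intro sum_mono mult_left_mono) auto
  finally show ?thesis
    using assms by (auto intro: sum_nonneg)
qed

text \<open>For \<open>v > 0\<close> this is \<open>ln w \<le> w - 1\<close> at
  \<open>w = m / v\<close>, multiplied by \<open>v\<close>.\<close>

lemma x_ln_x_above_tangent:
  fixes m v :: real
  assumes "0 < m" "0 \<le> v"
  shows "m * ln m + (1 + ln m) * (v - m) \<le> v * ln v"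
proof (cases "v = 0")
  case False
  with assms have v: "0 < v" by simp
  have "ln (m / v) \<le> m / v - 1" using assms v by (intro ln_le_minus_one) auto
  then have "v * ln (m / v) \<le> v * (m / v - 1)" using v by (intro mult_left_mono) auto
  then show ?thesis using v assms by (simp add: ln_div algebra_simps)
next
  case True
  then show ?thesis using assms(1) by (simp add: distrib_right)
qed

text \<open>Averaging the tangent inequality at the mean \<open>m\<close> cancels the linear
  term.\<close>

lemma x_ln_x_weighted_sum_le:
  fixes c v :: "'a \<Rightarrow> real"
  assumes "finite A" "\<And>a. a \<in> A \<Longrightarrow> 0 \<le> c a" "sum c A = 1" "\<And>a. a \<in> A \<Longrightarrow> 0 \<le> v a"
  defines "m \<equiv> (\<Sum>a\<in>A. c a * v a)"
  shows "m * ln m \<le> (\<Sum>a\<in>A. c a * (v a * ln (v a)))"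
proof (cases "m = 0")
  case True
  \<comment> \<open>There is no tangent at 0, but a zero mean of nonnegative values forces each
    product to vanish, so both sides are zero.\<close>
  then have "\<forall>a\<in>A. c a * v a = 0"
    unfolding m_def using assms by (subst (asm) sum_nonneg_eq_0_iff) auto
  then have "(\<Sum>a\<in>A. c a * (v a * ln (v a))) = 0"
    by (intro sum.neutral) auto
  then show ?thesis using True by simp
next
  case False
  have "0 \<le> m" unfolding m_def using assms by (intro sum_nonneg) auto
  with False have m: "0 < m" by simp
  have "m * ln m = (\<Sum>a\<in>A. c a * (m * ln m + (1 + ln m) * (v a - m)))"
  proof -
    have "(\<Sum>a\<in>A. c a * (m * ln m + (1 + ln m) * (v a - m)))
       = (\<Sum>a\<in>A. c a) * (m * ln m - (1 + ln m) * m) + (1 + ln m) * (\<Sum>a\<in>A. c a * v a)"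
      by (simp add: sum_distrib_left sum_distrib_right sum.distrib[symmetric] algebra_simps)
    then show ?thesis unfolding m_def[symmetric] assms(3) by (simp add: algebra_simps)
  qed
  also have "\<dots> \<le> (\<Sum>a\<in>A. c a * (v a * ln (v a)))"
    using assms(2,4) m by (intro sum_mono mult_left_mono x_ln_x_above_tangent) auto
  finally show ?thesis .
qed

text \<open>The easy half of Rado's theorem. Equality of the sums comes from the two linear
  functions \<open>u\<close> and \<open>- u\<close>.\<close>

lemma in_perm_hull_imp_majorized_on:
  assumes "finite I" "in_perm_hull I x y"
  shows "majorized_on I y x"
proof -
  have "(\<Sum>i\<in>I. max 0 (y i - t)) \<le> (\<Sum>i\<in>I. max 0 (x i - t))" for t
    by (intro in_perm_hull_sum_convex_le[OF assms(2), of "\<lambda>u. max 0 (u - t)"]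
        pos_part_weighted_sum_le) auto
  moreover have "sum y I \<le> sum x I"
    by (rule in_perm_hull_sum_convex_le[OF assms(2), of "\<lambda>u. u"]) auto
  moreover have "(\<Sum>i\<in>I. - y i) \<le> (\<Sum>i\<in>I. - x i)"
    by (rule in_perm_hull_sum_convex_le[OF assms(2), of "\<lambda>u. - u"]) (auto simp: sum_negf)
  ultimately show ?thesis by (simp add: majorized_on_def sum_negf)
qed

section \<open>The polytope in terms of majorization\<close>

(* \<open>inv\<close> is written out because the imported HOL-Algebra syntax makes it ambiguous. *)
lemma perm_vec_index:
  assumes "x \<in> carrier_vec d" "\<pi> permutes {..<d}" "b < d"
  shows "perm_vec x \<pi> $ b = x $ (inv_into UNIV \<pi> b)"
proof -
  have "perm_vec x \<pi> $ b = (\<Sum>i<d. x $ i * (if \<pi> i = b then 1 else 0))"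
    using assms by (simp add: perm_vec_def vec_mult_mat_def perm_mat_def scalar_prod_def
        atLeast0LessThan)
  also have "\<dots> = (\<Sum>i<d. if i = inv_into UNIV \<pi> b then x $ i else 0)"
  proof (intro sum.cong refl)
    fix i
    have "\<pi> i = b \<longleftrightarrow> i = inv_into UNIV \<pi> b"
      using permutes_inv_eq[OF assms(2), of b i] by auto
    then show "x $ i * (if \<pi> i = b then 1 else 0) = (if i = inv_into UNIV \<pi> b then x $ i else 0)"
      by simp
  qed
  also have "\<dots> = x $ (inv_into UNIV \<pi> b)"
    using permutes_in_image[OF permutes_inv[OF assms(2)], of b] assms(3)
    by (simp add: sum.delta)
  finally show ?thesis .
qed

text \<open>Inverting the summation variable moves the inverse from the index of \<open>x\<close> to
  the coefficient, which gives the shape of \<open>in_perm_hull\<close>.\<close>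

lemma finsum_vec_hat_perm_vec:
  assumes "x \<in> carrier_vec d"
  shows "finsum_vec TYPE(real) (d - 1) (\<lambda>\<pi>. c \<pi> \<cdot>\<^sub>v hat (perm_vec x \<pi>)) (perms d) =
    vec (d - 1) (\<lambda>b. \<Sum>\<pi> | \<pi> permutes {..<d}. c (inv_into UNIV \<pi>) * x $ \<pi> b)"
    (is "finsum_vec _ _ ?F _ = ?v")
proof (rule eq_vecI)
  have dim: "dim_vec (perm_vec x \<pi>) = d" for \<pi>
    using assms by (simp add: perm_vec_def vec_mult_mat_def perm_mat_def)
  have F: "?F \<in> perms d \<rightarrow> carrier_vec (d - 1)"
    by (auto simp: hat_def dim)
  show "dim_vec (finsum_vec TYPE(real) (d - 1) ?F (perms d)) = dim_vec ?v"
    using finsum_vec_closed[OF F] by simp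
  fix b assume "b < dim_vec ?v"
  then have b: "b < d - 1" by simp
  have "finsum_vec TYPE(real) (d - 1) ?F (perms d) $ b = (\<Sum>\<pi>\<in>perms d. ?F \<pi> $ b)"
    using F b by (intro index_finsum_vec) (auto simp: perms_def finite_permutations)
  also have "\<dots> = (\<Sum>\<pi> | \<pi> permutes {..<d}. c \<pi> * x $ (inv_into UNIV \<pi> b))"
  proof (intro sum.cong)
    fix \<pi> assume "\<pi> \<in> {\<pi>. \<pi> permutes {..<d}}"
    then have "perm_vec x \<pi> $ b = x $ inv_into UNIV \<pi> b"
      using b by (intro perm_vec_index[OF assms]) auto
    then show "?F \<pi> $ b = c \<pi> * x $ inv_into UNIV \<pi> b"
      using b by (simp add: hat_def dim vec_first_def)
  qed (simp add: perms_def)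
  also have "\<dots> = (\<Sum>\<pi> | \<pi> permutes {..<d}. c (inv_into UNIV \<pi>) * x $ \<pi> b)"
    by (subst sum_permutations_inverse, intro sum.cong) (auto simp: permutes_inv_inv)
  finally show "finsum_vec TYPE(real) (d - 1) ?F (perms d) $ b = ?v $ b"
    using b by simp
qed

text \<open>Both halves of Rado's theorem combined; inclusion of polytopes thereby reduces to
  transitivity of majorization.\<close>

lemma perm_polytope_eq_majorized:
  assumes x: "x \<in> carrier_vec d"
  shows "perm_polytope x = hat ` {y \<in> carrier_vec d. majorized_on {..<d} (($) y) (($) x)}"
    (is "_ = hat ` ?M")
proof (intro equalityI subsetI)
  let ?P = "{\<pi>. \<pi> permutes {..<d}}"
  fix t assume "t \<in> perm_polytope x"
  then obtain c where c: "\<And>\<pi>. \<pi> permutes {..<d} \<Longrightarrow> 0 \<le> c \<pi>" "(\<Sum>\<pi>\<in>?P. c \<pi>) = 1"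
    and t: "t = vec (d - 1) (\<lambda>b. \<Sum>\<pi>\<in>?P. c (inv_into UNIV \<pi>) * x $ \<pi> b)"
    using x finsum_vec_hat_perm_vec[OF x] by (auto simp: perm_polytope_def perms_def)
  \<comment> \<open>The same combination with all \<open>d\<close> coordinates kept, so that its
    truncation is \<open>t\<close>.\<close>
  define y where "y = vec d (\<lambda>b. \<Sum>\<pi>\<in>?P. c (inv_into UNIV \<pi>) * x $ \<pi> b)"
  have "in_perm_hull {..<d} (($) x) (($) y)"
    unfolding in_perm_hull_def
    using c sum_permutations_inverse[of c "{..<d}"]
    by (intro exI[of _ "\<lambda>\<pi>. c (inv_into UNIV \<pi>)"]) (auto simp: y_def permutes_inv)
  then have "y \<in> ?M"
    using in_perm_hull_imp_majorized_on by (auto simp: y_def)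
  moreover have "t = hat y" by (auto simp: t y_def hat_def vec_first_def)
  ultimately show "t \<in> hat ` ?M" by blast
next
  let ?P = "{\<pi>. \<pi> permutes {..<d}}"
  fix t assume "t \<in> hat ` ?M"
  then obtain y where y: "y \<in> carrier_vec d" "majorized_on {..<d} (($) y) (($) x)" "t = hat y"
    by blast
  from y(2) have "in_perm_hull {..<d} (($) x) (($) y)"
    by (intro majorized_on_imp_in_perm_hull) auto
  then obtain c where c: "\<And>\<pi>. \<pi> permutes {..<d} \<Longrightarrow> 0 \<le> c \<pi>" "(\<Sum>\<pi>\<in>?P. c \<pi>) = 1"
    and yi: "\<And>i. i < d \<Longrightarrow> y $ i = (\<Sum>\<pi>\<in>?P. c \<pi> * x $ \<pi> i)"
    unfolding in_perm_hull_def by auto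
  \<comment> \<open>Inverting here cancels the inverse that the permutation matrices
    introduce.\<close>
  let ?c = "\<lambda>\<pi>. c (inv_into UNIV \<pi>)"
  have "t = vec (d - 1) (\<lambda>b. \<Sum>\<pi>\<in>?P. ?c (inv_into UNIV \<pi>) * x $ \<pi> b)"
    using y(1) by (auto simp: y(3) hat_def vec_first_def yi permutes_inv_inv intro!: sum.cong)
  then have "t = finsum_vec TYPE(real) (d - 1) (\<lambda>\<pi>. ?c \<pi> \<cdot>\<^sub>v hat (perm_vec x \<pi>)) (perms d)"
    by (simp only: finsum_vec_hat_perm_vec[OF x])
  moreover have "(\<Sum>\<pi>\<in>?P. ?c \<pi>) = 1"
    using c sum_permutations_inverse[of c "{..<d}"] by simp
  ultimately show "t \<in> perm_polytope x"
    using x c by (auto simp: perm_polytope_def perms_def permutes_inv intro!: exI[of _ ?c])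
qed

text \<open>Nonnegativity is read off the hull representation, the total from the equality of
  sums.\<close>

lemma prob_vec_majorized:
  assumes "prob_vec d x" "y \<in> carrier_vec d" "majorized_on {..<d} (($) y) (($) x)"
  shows "prob_vec d y"
proof -
  have "in_perm_hull {..<d} (($) x) (($) y)"
    using assms by (intro majorized_on_imp_in_perm_hull) auto
  then obtain c where c: "\<And>\<pi>. \<pi> permutes {..<d} \<Longrightarrow> 0 \<le> c \<pi>"
    and y: "\<And>i. i < d \<Longrightarrow> y $ i = (\<Sum>\<pi> | \<pi> permutes {..<d}. c \<pi> * x $ \<pi> i)"
    unfolding in_perm_hull_def by auto
  have "0 \<le> y $ i" if "i < d" for i
  proof -
    have "0 \<le> x $ \<pi> i" if "\<pi> permutes {..<d}" for \<pi>
      using assms(1) permutes_in_image[OF that, of i] \<open>i < d\<close> by (auto simp: prob_vec_def)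
    then show ?thesis using c that by (auto simp: y intro!: sum_nonneg)
  qed
  then show ?thesis
    using assms by (auto simp: prob_vec_def majorized_on_def)
qed

lemma hat_inj_prob_vec:
  assumes "d \<ge> 1" "prob_vec d y" "prob_vec d z" "hat y = hat z"
  shows "y = z"
proof -
  obtain n where n: "d = Suc n" using assms(1) by (cases d) auto
  have dims: "dim_vec y = d" "dim_vec z = d" using assms by (auto simp: prob_vec_def)
  have eq: "y $ i = z $ i" if "i < n" for i
    using arg_cong[OF assms(4), of "\<lambda>v. v $ i"] that by (simp add: hat_def vec_first_def dims n)
  then have "(\<Sum>i<n. y $ i) = (\<Sum>i<n. z $ i)" by (intro sum.cong) auto
  then have "y $ n = z $ n" using assms(2,3) by (simp add: prob_vec_def n)
  with eq show ?thesis by (intro eq_vecI) (auto simp: dims n less_Suc_eq)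
qed

text \<open>Every vector majorized by \<open>x\<close> is a probability vector, and
  \<open>hat\<close> is injective on those, so truncation loses nothing.\<close>

lemma prob_vecs_in_polytope_eq_majorized:
  assumes "d \<ge> 1" "prob_vec d x"
  shows "prob_vecs_in_polytope x =
    {y \<in> carrier_vec d. majorized_on {..<d} (($) y) (($) x)}" (is "_ = ?M")
proof -
  have x: "x \<in> carrier_vec d" using assms by (simp add: prob_vec_def)
  then have eq: "prob_vecs_in_polytope x = {y. prob_vec d y \<and> hat y \<in> hat ` ?M}"
    by (simp add: prob_vecs_in_polytope_def perm_polytope_eq_majorized[OF x])
  have M: "prob_vec d y" if "y \<in> ?M" for y
    using that prob_vec_majorized[OF assms(2)] by simp
  show ?thesis
    unfolding eq
  proof (intro equalityI subsetI)
    fix y assume "y \<in> {y. prob_vec d y \<and> hat y \<in> hat ` ?M}"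
    then obtain z where y: "prob_vec d y" and z: "z \<in> ?M" and "hat y = hat z" by blast
    then have "y = z" using hat_inj_prob_vec[OF assms(1)] M by blast
    then show "y \<in> ?M" using z by simp
  qed (use M in blast)
qed

text \<open>Jensen for \<open>u * ln u\<close> on the hull, with the sign reversed;
  \<open>prob_vec d x\<close> keeps the values in the domain of convexity.\<close>

lemma entropy_majorized:
  assumes "prob_vec d x" "y \<in> carrier_vec d" "majorized_on {..<d} (($) y) (($) x)"
  shows "entropy x \<le> entropy y"
proof -
  have "(\<Sum>i<d. y $ i * ln (y $ i)) \<le> (\<Sum>i<d. x $ i * ln (x $ i))"
  proof (rule in_perm_hull_sum_convex_le[of _ _ _ "\<lambda>u. u * ln u"])
    show "in_perm_hull {..<d} (($) x) (($) y)"
      using assms by (intro majorized_on_imp_in_perm_hull) auto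
  next
    fix c :: "(nat \<Rightarrow> nat) \<Rightarrow> real" and v :: "(nat \<Rightarrow> nat) \<Rightarrow> real"
    let ?m = "\<Sum>\<pi> | \<pi> permutes {..<d}. c \<pi> * v \<pi>"
    assume "\<And>\<pi>. \<pi> permutes {..<d} \<Longrightarrow> 0 \<le> c \<pi>"
      "(\<Sum>\<pi> | \<pi> permutes {..<d}. c \<pi>) = 1"
      "\<And>\<pi>. \<pi> permutes {..<d} \<Longrightarrow> v \<pi> \<in> ($) x ` {..<d}"
    then show "?m * ln ?m \<le> (\<Sum>\<pi> | \<pi> permutes {..<d}. c \<pi> * (v \<pi> * ln (v \<pi>)))"
      using assms(1)
      by (intro x_ln_x_weighted_sum_le) (fastforce simp: finite_permutations prob_vec_def)+
  qed
  moreover have "dim_vec x = d" "dim_vec y = d" using assms by (auto simp: prob_vec_def)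
  ultimately show ?thesis by (simp add: entropy_def)
qed

section \<open>Doubly stochastic matrices and the uniform vector\<close>

text \<open>Column sums 1 make each entry of the product a weighted average of \<open>x\<close>; row
  sums 1 give each entry of \<open>x\<close> total weight 1 once the sums are exchanged.\<close>

lemma doubly_stochastic_majorized:
  assumes x: "x \<in> carrier_vec d" and D: "doubly_stochastic d D"
  shows "x \<^sub>v* D \<in> carrier_vec d" "majorized_on {..<d} (($) (x \<^sub>v* D)) (($) x)"
proof -
  have D': "D \<in> carrier_mat d d" "\<And>a b. a < d \<Longrightarrow> b < d \<Longrightarrow> 0 \<le> D $$ (a, b)"
    "\<And>a. a < d \<Longrightarrow> (\<Sum>b<d. D $$ (a, b)) = 1" "\<And>b. b < d \<Longrightarrow> (\<Sum>a<d. D $$ (a, b)) = 1"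
    using D by (auto simp: doubly_stochastic_def)
  show "x \<^sub>v* D \<in> carrier_vec d" using D'(1) by (auto simp: vec_mult_mat_def)
  have y: "(x \<^sub>v* D) $ b = (\<Sum>a<d. D $$ (a, b) * x $ a)" if "b < d" for b
    using D'(1) x that
    by (auto simp: vec_mult_mat_def scalar_prod_def atLeast0LessThan mult.commute intro!: sum.cong)
  have swap: "(\<Sum>b<d. \<Sum>a<d. D $$ (a, b) * f a) = (\<Sum>a<d. f a)" for f
  proof -
    have "(\<Sum>b<d. \<Sum>a<d. D $$ (a, b) * f a) = (\<Sum>a<d. (\<Sum>b<d. D $$ (a, b)) * f a)"
      by (subst sum.swap) (simp add: sum_distrib_right)
    then show ?thesis using D'(3) by simp
  qed
  have "(\<Sum>b<d. max 0 ((x \<^sub>v* D) $ b - t)) \<le> (\<Sum>a<d. max 0 (x $ a - t))" for t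
  proof -
    have "(\<Sum>b<d. max 0 ((x \<^sub>v* D) $ b - t)) \<le> (\<Sum>b<d. \<Sum>a<d. D $$ (a, b) * max 0 (x $ a - t))"
    proof (intro sum_mono)
      fix b assume "b \<in> {..<d}"
      then show "max 0 ((x \<^sub>v* D) $ b - t) \<le> (\<Sum>a<d. D $$ (a, b) * max 0 (x $ a - t))"
        using D'(2,4) y[of b] pos_part_weighted_sum_le[of "{..<d}" "\<lambda>a. D $$ (a, b)" "($) x" t]
        by simp
    qed
    then show ?thesis by (simp add: swap)
  qed
  moreover have "(\<Sum>b<d. (x \<^sub>v* D) $ b) = (\<Sum>a<d. x $ a)"
    using swap[of "($) x"] y by simp
  ultimately show "majorized_on {..<d} (($) (x \<^sub>v* D)) (($) x)"
    by (simp add: majorized_on_def)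
qed

text \<open>The uniform side is the positive part of the sum of all \<open>x $ i - t\<close>, which
  is at most the sum of the positive parts.\<close>

lemma uniform_majorized:
  assumes "d \<ge> 1" "prob_vec d x"
  shows "majorized_on {..<d} (($) (vec d (\<lambda>_. 1 / real d))) (($) x)"
proof -
  have "(\<Sum>i<d. max 0 (vec d (\<lambda>_. 1 / real d) $ i - t)) \<le> (\<Sum>i<d. max 0 (x $ i - t))" for t
  proof -
    have "(\<Sum>i<d. max 0 (vec d (\<lambda>_. 1 / real d) $ i - t)) = d * max 0 (1 / d - t)"
      by simp
    also have "\<dots> = max 0 (1 - d * t)"
      using assms(1) by (auto simp: max_def field_simps)
    also have "1 - d * t = (\<Sum>i<d. x $ i - t)"
      using assms(2) by (simp add: prob_vec_def sum_subtractf)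
    also have "max 0 \<dots> \<le> (\<Sum>i<d. max 0 (x $ i - t))"
      by (auto intro!: sum_mono sum_nonneg)
    finally show ?thesis .
  qed
  then show ?thesis using assms by (simp add: majorized_on_def prob_vec_def)
qed

section \<open>Polytope inclusions and entropy bounds\<close>

lemma hat_prob_vec_in_std_simplex:
  assumes "prob_vec d y"
  shows "hat y \<in> std_simplex (d - 1)"
proof -
  have "(\<Sum>i<d - 1. y $ i) \<le> (\<Sum>i<d. y $ i)"
    using assms by (intro sum_mono2) (auto simp: prob_vec_def)
  then show ?thesis
    using assms by (auto simp: prob_vec_def std_simplex_def hat_def vec_first_def)
qed

lemma perm_polytope_subset_std_simplex:
  assumes "prob_vec d x"
  shows "perm_polytope x \<subseteq> std_simplex (d - 1)"
proof -
  have x: "x \<in> carrier_vec d" using assms by (simp add: prob_vec_def)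
  show ?thesis
    unfolding perm_polytope_eq_majorized[OF x]
    using hat_prob_vec_in_std_simplex prob_vec_majorized[OF assms] by blast
qed

lemma perm_polytope_mono:
  assumes "x \<in> carrier_vec d" "y \<in> carrier_vec d" "majorized_on {..<d} (($) y) (($) x)"
  shows "perm_polytope y \<subseteq> perm_polytope x"
  unfolding perm_polytope_eq_majorized[OF assms(1)] perm_polytope_eq_majorized[OF assms(2)]
  using majorized_on_trans[OF _ assms(3)] by blast

lemma uniform_point_subset_perm_polytope:
  assumes "d \<ge> 1" "prob_vec d x"
  shows "uniform_point d \<subseteq> perm_polytope x"
proof -
  have "vec (d - 1) (\<lambda>_. 1 / real d) = hat (vec d (\<lambda>_. 1 / real d))"
    by (auto simp: hat_def vec_first_def)
  then show ?thesis
    using assms uniform_majorized[OF assms] perm_polytope_eq_majorized[of x d]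
    by (auto simp: uniform_point_def prob_vec_def)
qed

lemma entropy_le_ln:
  assumes "d \<ge> 1" "prob_vec d x"
  shows "entropy x \<le> ln (real d)"
proof -
  have "entropy x \<le> entropy (vec d (\<lambda>_. 1 / real d))"
    using assms by (intro entropy_majorized[of d] uniform_majorized) auto
  also have "\<dots> = ln (real d)" using assms by (simp add: entropy_def ln_div)
  finally show ?thesis .
qed

text \<open>The minimum is attained at \<open>x\<close>, which majorizes itself.\<close>

lemma is_minimum_entropy:
  assumes "d \<ge> 1" "prob_vec d x"
  shows "is_minimum (entropy ` prob_vecs_in_polytope x) (entropy x)"
proof -
  have "x \<in> carrier_vec d" using assms(2) by (simp add: prob_vec_def)
  then show ?thesis
    unfolding is_minimum_def prob_vecs_in_polytope_eq_majorized[OF assms]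
    using majorized_on_refl entropy_majorized[OF assms(2)] by blast
qed

theorem mainTheorem2:
  fixes d :: nat
    and x :: "nat \<Rightarrow> real vec"
    and D :: "nat \<Rightarrow> nat \<Rightarrow> real mat"
  assumes "d \<ge> 1"
    and "prob_vec d (x 1)"
    and "\<And>s. s \<ge> 1 \<Longrightarrow> doubly_stochastic d (D s (s + 1))"
    and "\<And>s. s \<ge> 1 \<Longrightarrow> x (s + 1) = x s \<^sub>v* D s (s + 1)"
  shows "(\<forall>s\<ge>1. uniform_point d \<subseteq> perm_polytope (x (s + 1)) \<and>
           perm_polytope (x (s + 1)) \<subseteq> perm_polytope (x s) \<and>
           perm_polytope (x s) \<subseteq> std_simplex (d - 1)) \<and>
         (\<forall>s\<ge>1. is_minimum (entropy ` prob_vecs_in_polytope (x s)) (entropy (x s)) \<and>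
           entropy (x s) \<le> entropy (x (s + 1)) \<and>
           entropy (x (s + 1)) \<le> ln (real d))"
proof -
  \<comment> \<open>Each vector of the chain is majorized by its predecessor and so inherits being a
    probability vector.\<close>
  have prob: "prob_vec d (x s)" if "s \<ge> 1" for s
    using that
  proof (induction s rule: dec_induct)
    case base
    show ?case by (rule assms(2))
  next
    case (step s)
    then show ?case
      using prob_vec_majorized[OF step.IH] doubly_stochastic_majorized[OF _ assms(3)[of s]]
        assms(4)[of s] by (simp add: prob_vec_def)
  qed
  have carrier: "x s \<in> carrier_vec d" if "s \<ge> 1" for s
    using prob[OF that] by (simp add: prob_vec_def)
  have maj: "majorized_on {..<d} (($) (x (s + 1))) (($) (x s))" if "s \<ge> 1" for s
    using doubly_stochastic_majorized(2)[OF carrier[OF that] assms(3)[OF that]] assms(4)[OF that]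
    by simp
  show ?thesis
  proof (intro conjI allI impI)
    fix s :: nat assume s: "s \<ge> 1"
    then have s': "s + 1 \<ge> 1" by simp
    show "uniform_point d \<subseteq> perm_polytope (x (s + 1))"
      by (rule uniform_point_subset_perm_polytope[OF assms(1) prob[OF s']])
    show "perm_polytope (x (s + 1)) \<subseteq> perm_polytope (x s)"
      by (rule perm_polytope_mono[OF carrier[OF s] carrier[OF s'] maj[OF s]])
    show "perm_polytope (x s) \<subseteq> std_simplex (d - 1)"
      by (rule perm_polytope_subset_std_simplex[OF prob[OF s]])
    show "is_minimum (entropy ` prob_vecs_in_polytope (x s)) (entropy (x s))"
      by (rule is_minimum_entropy[OF assms(1) prob[OF s]])
    show "entropy (x s) \<le> entropy (x (s + 1))"
      by (rule entropy_majorized[OF prob[OF s] carrier[OF s'] maj[OF s]])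
    show "entropy (x (s + 1)) \<le> ln (real d)"
      by (rule entropy_le_ln[OF assms(1) prob[OF s']])
  qed
qed

end
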